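(* There exist a Hilbert space $H$, an unbounded self-adjoint operator $A$ in $H$ and an unbounded densely defined closed operator $B$ in $H$ such that both of the following hold: (i) for every $T\in B(H)$, $TA\subset BT$ implies $T=0$; (ii) for every $S\in B(H)$, $SB\subset AS$ implies $S=0$.
   Context: $H$ is a complex Hilbert space and $B(H)$ denotes the bounded everywhere-defined linear operators on $H$. For operators $R,S$ in $H$, $R\subset S$ means $D(R)\subset D(S)$ and $Rx=Sx$ for all $x\in D(R)$; products carry their natural domains, $D(RS)=\{x\in D(S): Sx\in D(R)\}$. *)

theory Defs
  imports "HOL-Analysis.Abstract_Metric_Spaces" "HOL-Algebra.Module"
begin

section \<open>Complex Hilbert spaces with an explicit carrier\<close>

definition complex_ring :: "complex ring" where
  "complex_ring = \<lparr>carrier = UNIV, mult = (*), one = 1, zero = 0, add = (+)\<rparr>"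

text \<open>As for every HOL-Algebra module, the fields mult and one inherited from the ring record
  carry no meaning.\<close>

record 'a inner_product_space = "(complex, 'a) module" +
  cinner :: "'a \<Rightarrow> 'a \<Rightarrow> complex"

definition hnorm :: "'a inner_product_space \<Rightarrow> 'a \<Rightarrow> real" where
  "hnorm H x = sqrt (Re (cinner H x x))"

text \<open>The locale \<^locale>\<open>Metric_space\<close> requires nonnegativity and symmetry of the distance on the
  whole type, hence the default value outside the carrier.\<close>

definition hdist :: "'a inner_product_space \<Rightarrow> 'a \<Rightarrow> 'a \<Rightarrow> real" where
  "hdist H x y =
    (if x \<in> carrier H \<and> y \<in> carrier H then hnorm H (x \<ominus>\<^bsub>H\<^esub> y) else 0)"

definition htopology :: "'a inner_product_space \<Rightarrow> 'a topology" where
  "htopology H = Metric_space.mtopology (carrier H) (hdist H)"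

locale complex_inner_product_space = module complex_ring H
  for H :: "'a inner_product_space" (structure) +
  assumes cinner_add_left:
      "\<lbrakk>x \<in> carrier H; y \<in> carrier H; z \<in> carrier H\<rbrakk> \<Longrightarrow>
        cinner H (x \<oplus>\<^bsub>H\<^esub> y) z = cinner H x z + cinner H y z"
    and cinner_smult_left:
      "\<lbrakk>x \<in> carrier H; y \<in> carrier H\<rbrakk> \<Longrightarrow> cinner H (c \<odot>\<^bsub>H\<^esub> x) y = c * cinner H x y"
    and cinner_commute:
      "\<lbrakk>x \<in> carrier H; y \<in> carrier H\<rbrakk> \<Longrightarrow> cinner H x y = cnj (cinner H y x)"
    and cinner_pos:
      "\<lbrakk>x \<in> carrier H; x \<noteq> \<zero>\<^bsub>H\<^esub>\<rbrakk> \<Longrightarrow> 0 < Re (cinner H x x)"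

locale complex_hilbert_space = complex_inner_product_space +
  assumes complete: "Metric_space.mcomplete (carrier H) (hdist H)"


section \<open>Operators in a Hilbert space\<close>

text \<open>A (not necessarily everywhere defined) operator in \<open>H\<close> is a partial map \<open>R :: 'a \<rightharpoonup> 'a\<close> with
  domain \<open>dom R\<close>. With this encoding, \<open>R \<subseteq>\<^sub>m S\<close> is the extension relation and \<open>R \<circ>\<^sub>m S\<close> is the
  product with its natural domain.\<close>

definition linear_operator :: "'a inner_product_space \<Rightarrow> ('a \<rightharpoonup> 'a) \<Rightarrow> bool" where
  "linear_operator H R \<longleftrightarrow>
    submodule (dom R) complex_ring H \<and>
    ran R \<subseteq> carrier H \<and>
    (\<forall>x\<in>dom R. \<forall>y\<in>dom R. the (R (x \<oplus>\<^bsub>H\<^esub> y)) = the (R x) \<oplus>\<^bsub>H\<^esub> the (R y)) \<and>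
    (\<forall>c. \<forall>x\<in>dom R. the (R (c \<odot>\<^bsub>H\<^esub> x)) = c \<odot>\<^bsub>H\<^esub> the (R x))"

definition bounded_operator :: "'a inner_product_space \<Rightarrow> ('a \<rightharpoonup> 'a) \<Rightarrow> bool" where
  "bounded_operator H R \<longleftrightarrow> (\<exists>K. \<forall>x\<in>dom R. hnorm H (the (R x)) \<le> K * hnorm H x)"

definition bounded_operators :: "'a inner_product_space \<Rightarrow> ('a \<rightharpoonup> 'a) set" where
  "bounded_operators H =
    {T. linear_operator H T \<and> dom T = carrier H \<and> bounded_operator H T}"

definition zero_operator :: "'a inner_product_space \<Rightarrow> 'a \<rightharpoonup> 'a" where
  "zero_operator H = (\<lambda>x. Some \<zero>\<^bsub>H\<^esub>) |` carrier H"

definition densely_defined :: "'a inner_product_space \<Rightarrow> ('a \<rightharpoonup> 'a) \<Rightarrow> bool" where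
  "densely_defined H R \<longleftrightarrow> htopology H closure_of dom R = carrier H"

definition closed_operator :: "'a inner_product_space \<Rightarrow> ('a \<rightharpoonup> 'a) \<Rightarrow> bool" where
  "closed_operator H R \<longleftrightarrow>
    closedin (prod_topology (htopology H) (htopology H)) (Map.graph R)"

text \<open>The vector \<open>z\<close> below is unique if \<open>R\<close> is densely defined; the adjoint is used only for such
  operators.\<close>

definition adjoint_operator :: "'a inner_product_space \<Rightarrow> ('a \<rightharpoonup> 'a) \<Rightarrow> 'a \<rightharpoonup> 'a" where
  "adjoint_operator H R = (\<lambda>y.
    let P = (\<lambda>z. z \<in> carrier H \<and> (\<forall>x\<in>dom R. cinner H (the (R x)) y = cinner H x z))
    in if y \<in> carrier H \<and> (\<exists>z. P z) then Some (THE z. P z) else None)"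

definition selfadjoint_operator :: "'a inner_product_space \<Rightarrow> ('a \<rightharpoonup> 'a) \<Rightarrow> bool" where
  "selfadjoint_operator H A \<longleftrightarrow>
    linear_operator H A \<and> densely_defined H A \<and> adjoint_operator H A = A"


section \<open>The norm distance is a metric\<close>

context complex_inner_product_space
begin

lemma cinner_add_right:
  assumes "x \<in> carrier H" "y \<in> carrier H" "z \<in> carrier H"
  shows "cinner H z (x \<oplus>\<^bsub>H\<^esub> y) = cinner H z x + cinner H z y"
  using assms cinner_commute[of z "x \<oplus>\<^bsub>H\<^esub> y"] cinner_commute[of z x] cinner_commute[of z y]
  by (simp add: cinner_add_left)

lemma cinner_smult_right:
  assumes "x \<in> carrier H" "y \<in> carrier H"
  shows "cinner H x (c \<odot>\<^bsub>H\<^esub> y) = cnj c * cinner H x y"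
proof -
  have "c \<odot>\<^bsub>H\<^esub> y \<in> carrier H"
    using assms smult_closed[of c y] by (simp add: complex_ring_def)
  then show ?thesis
    using assms cinner_commute[of x "c \<odot>\<^bsub>H\<^esub> y"] cinner_commute[of x y]
    by (simp add: cinner_smult_left)
qed

lemma cinner_zero: "cinner H \<zero>\<^bsub>H\<^esub> \<zero>\<^bsub>H\<^esub> = 0"
  using cinner_add_left[of "\<zero>\<^bsub>H\<^esub>" "\<zero>\<^bsub>H\<^esub>" "\<zero>\<^bsub>H\<^esub>"] by simp

lemma cinner_nonneg: "x \<in> carrier H \<Longrightarrow> 0 \<le> Re (cinner H x x)"
  using cinner_pos[of x] cinner_zero by (cases "x = \<zero>\<^bsub>H\<^esub>") auto

lemma Re_cinner_add_smult:
  assumes "x \<in> carrier H" "y \<in> carrier H"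
  shows "Re (cinner H (x \<oplus>\<^bsub>H\<^esub> of_real t \<odot>\<^bsub>H\<^esub> y) (x \<oplus>\<^bsub>H\<^esub> of_real t \<odot>\<^bsub>H\<^esub> y)) =
    Re (cinner H x x) + 2 * t * Re (cinner H x y) + t\<^sup>2 * Re (cinner H y y)"
proof -
  have c: "of_real t \<odot>\<^bsub>H\<^esub> y \<in> carrier H"
    using assms smult_closed[of "of_real t" y] by (simp add: complex_ring_def)
  have "Re (cinner H y x) = Re (cinner H x y)"
    using cinner_commute[of y x] assms by simp
  then show ?thesis
    using assms c by (simp add: cinner_add_left cinner_add_right cinner_smult_left
        cinner_smult_right algebra_simps power2_eq_square)
qed

lemma Re_cinner_le:
  assumes "x \<in> carrier H" "y \<in> carrier H"
  shows "Re (cinner H x y) \<le> hnorm H x * hnorm H y"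
proof -
  let ?a = "Re (cinner H x x)" and ?b = "Re (cinner H x y)" and ?c = "Re (cinner H y y)"
  have q: "0 \<le> ?a + 2 * t * ?b + t\<^sup>2 * ?c" for t
  proof -
    have "x \<oplus>\<^bsub>H\<^esub> of_real t \<odot>\<^bsub>H\<^esub> y \<in> carrier H"
      using assms smult_closed[of "of_real t" y] by (simp add: complex_ring_def)
    then show ?thesis
      using cinner_nonneg Re_cinner_add_smult[OF assms] by metis
  qed
  have "?b\<^sup>2 \<le> ?a * ?c"
  proof (cases "y = \<zero>\<^bsub>H\<^esub>")
    case True
    have "cinner H x \<zero>\<^bsub>H\<^esub> = 0"
      using cinner_add_right[of "\<zero>\<^bsub>H\<^esub>" "\<zero>\<^bsub>H\<^esub>" x] assms by simp
    then show ?thesis using True cinner_zero by simp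
  next
    case False
    then have "0 < ?c" using cinner_pos assms by simp
    then show ?thesis using q[of "- ?b / ?c"]
      by (simp add: field_simps power2_eq_square)
  qed
  then have "\<bar>?b\<bar> \<le> sqrt (?a * ?c)"
    using real_sqrt_le_mono by fastforce
  then show ?thesis by (simp add: hnorm_def real_sqrt_mult)
qed

lemma hnorm_triangle:
  assumes "x \<in> carrier H" "y \<in> carrier H"
  shows "hnorm H (x \<oplus>\<^bsub>H\<^esub> y) \<le> hnorm H x + hnorm H y"
proof -
  have 1: "1 \<odot>\<^bsub>H\<^esub> y = y"
    using smult_one[of y] assms by (simp add: complex_ring_def)
  have "Re (cinner H (x \<oplus>\<^bsub>H\<^esub> y) (x \<oplus>\<^bsub>H\<^esub> y)) =
      (hnorm H x)\<^sup>2 + 2 * Re (cinner H x y) + (hnorm H y)\<^sup>2"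
    using Re_cinner_add_smult[of x y 1] assms 1 cinner_nonneg by (simp add: hnorm_def)
  also have "\<dots> \<le> (hnorm H x + hnorm H y)\<^sup>2"
    using Re_cinner_le[OF assms] by (simp add: power2_eq_square algebra_simps)
  finally show ?thesis
    using assms cinner_nonneg
    by (simp add: hnorm_def real_le_lsqrt)
qed

lemma Metric_space_hdist: "Metric_space (carrier H) (hdist H)"
proof
  fix x y
  show "0 \<le> hdist H x y"
    by (simp add: hdist_def hnorm_def cinner_nonneg)
  show "hdist H x y = hdist H y x"
  proof (cases "x \<in> carrier H \<and> y \<in> carrier H")
    case True
    let ?d = "y \<ominus>\<^bsub>H\<^esub> x"
    have d: "?d \<in> carrier H" using True by simp
    have m: "(- 1) \<odot>\<^bsub>H\<^esub> ?d = x \<ominus>\<^bsub>H\<^esub> y"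
    proof -
      have s: "(- 1) \<odot>\<^bsub>H\<^esub> ?d \<in> carrier H" "1 \<odot>\<^bsub>H\<^esub> ?d = ?d" "0 \<odot>\<^bsub>H\<^esub> ?d = \<zero>\<^bsub>H\<^esub>"
        using d smult_closed[of "- 1" ?d] smult_one[of ?d] smult_l_null[of ?d]
        by (simp_all add: complex_ring_def)
      then have "(- 1) \<odot>\<^bsub>H\<^esub> ?d \<oplus>\<^bsub>H\<^esub> ?d = \<zero>\<^bsub>H\<^esub>"
        using smult_l_distr[of "- 1" 1 ?d] d by (simp add: complex_ring_def)
      then have "(- 1) \<odot>\<^bsub>H\<^esub> ?d = \<ominus>\<^bsub>H\<^esub> ?d"
        using s d M.minus_equality by simp
      also have "\<dots> = x \<ominus>\<^bsub>H\<^esub> y"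
        using True by (simp add: a_minus_def M.minus_add M.a_comm)
      finally show ?thesis .
    qed
    have "(- 1) \<odot>\<^bsub>H\<^esub> ?d \<in> carrier H" using m True by simp
    then have "cinner H (x \<ominus>\<^bsub>H\<^esub> y) (x \<ominus>\<^bsub>H\<^esub> y) = cinner H ?d ?d"
      unfolding m[symmetric] using d by (simp add: cinner_smult_left cinner_smult_right)
    then show ?thesis using True by (simp add: hdist_def hnorm_def)
  qed (auto simp: hdist_def)
next
  fix x y assume xy: "x \<in> carrier H" "y \<in> carrier H"
  then have "hdist H x y = 0 \<longleftrightarrow> x \<ominus>\<^bsub>H\<^esub> y = \<zero>\<^bsub>H\<^esub>"
    using cinner_pos[of "x \<ominus>\<^bsub>H\<^esub> y"] cinner_zero
    by (cases "x \<ominus>\<^bsub>H\<^esub> y = \<zero>\<^bsub>H\<^esub>") (simp_all add: hdist_def hnorm_def)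
  then show "hdist H x y = 0 \<longleftrightarrow> x = y"
    using xy by (metis M.add.inv_closed M.minus_equality M.minus_minus M.r_neg a_minus_def)
next
  fix x y z assume xyz: "x \<in> carrier H" "y \<in> carrier H" "z \<in> carrier H"
  then have "x \<ominus>\<^bsub>H\<^esub> z = (x \<ominus>\<^bsub>H\<^esub> y) \<oplus>\<^bsub>H\<^esub> (y \<ominus>\<^bsub>H\<^esub> z)"
    by (simp add: a_minus_def M.a_assoc M.r_neg1)
  then show "hdist H x z \<le> hdist H x y + hdist H y z"
    using hnorm_triangle[of "x \<ominus>\<^bsub>H\<^esub> y" "y \<ominus>\<^bsub>H\<^esub> z"] xyz by (simp add: hdist_def)
qed

end

end

theory Submission
  imports Defs
begin

text \<open>On the Hilbert space of square-summable sequences let \<open>A\<close> be multiplication by \<open>n\<close> and \<open>B\<close>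
  multiplication by \<open>- n - 1\<close>. Both are unbounded self-adjoint operators, and \<open>A\<close> is nonnegative
  while \<open>B\<close> is strictly negative, so they have no eigenvalue in common. If \<open>TA \<subset> BT\<close>, then \<open>T\<close>
  sends the unit vector \<open>e\<^sub>m\<close>, an eigenvector of \<open>A\<close>, either to \<open>0\<close> or to an eigenvector of \<open>B\<close>
  for the same eigenvalue; the latter is excluded, so \<open>T\<close> kills every \<open>e\<^sub>m\<close>. The span of the
  \<open>e\<^sub>m\<close> is dense and \<open>T\<close> is bounded, hence \<open>T = 0\<close>. The argument is symmetric in \<open>A\<close> and \<open>B\<close>,
  which settles both conditions at once (\<open>diagonal_intertwiner_eq_zero\<close>).

  The remaining work is to build the sequence space, where completeness (\<open>ell2_complete\<close>) and
  density of the finitely supported sequences (\<open>truncation_approximates\<close>) carry the weight, and to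
  show that a real diagonal operator with its maximal domain is self-adjoint and closed; both
  properties reduce to statements about single coordinates.\<close>

section \<open>The Hilbert space of square-summable sequences\<close>

definition square_summable :: "(nat \<Rightarrow> complex) \<Rightarrow> bool" where
  "square_summable x \<longleftrightarrow> summable (\<lambda>n. (cmod (x n))\<^sup>2)"

definition ell2 :: "(nat \<Rightarrow> complex) inner_product_space" where
  "ell2 = \<lparr>carrier = Collect square_summable, mult = (\<lambda>x y. x), one = (\<lambda>n. 0), zero = (\<lambda>n. 0),
    add = (\<lambda>x y n. x n + y n), smult = (\<lambda>c x n. c * x n),
    cinner = (\<lambda>x y. \<Sum>n. x n * cnj (y n))\<rparr>"

lemma ell2_sel [simp]:
  "carrier ell2 = Collect square_summable" "zero ell2 = (\<lambda>n. 0)"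
  "add ell2 = (\<lambda>x y n. x n + y n)" "smult ell2 = (\<lambda>c x n. c * x n)"
  "cinner ell2 = (\<lambda>x y. \<Sum>n. x n * cnj (y n))"
  by (simp_all add: ell2_def)

lemma square_summable_zero: "square_summable (\<lambda>n. 0)"
  by (simp add: square_summable_def)

lemma square_summable_add:
  assumes "square_summable x" "square_summable y"
  shows "square_summable (\<lambda>n. x n + y n)"
  unfolding square_summable_def
proof (rule summable_comparison_test')
  show "summable (\<lambda>n. 2 * ((cmod (x n))\<^sup>2 + (cmod (y n))\<^sup>2))"
    using assms unfolding square_summable_def by (intro summable_mult summable_add)
  fix n :: nat
  have "(cmod (x n + y n))\<^sup>2 \<le> (cmod (x n) + cmod (y n))\<^sup>2"
    by (simp add: norm_triangle_ineq power_mono)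
  also have "\<dots> \<le> 2 * ((cmod (x n))\<^sup>2 + (cmod (y n))\<^sup>2)"
    using sum_squares_bound[of "cmod (x n)" "cmod (y n)"] by (simp add: power2_sum)
  finally show "norm ((cmod (x n + y n))\<^sup>2) \<le> 2 * ((cmod (x n))\<^sup>2 + (cmod (y n))\<^sup>2)" by simp
qed

lemma square_summable_scale: "square_summable x \<Longrightarrow> square_summable (\<lambda>n. c * x n)"
  unfolding square_summable_def by (simp add: norm_mult power_mult_distrib summable_mult)

lemma square_summable_diff:
  assumes "square_summable x" "square_summable y"
  shows "square_summable (\<lambda>n. x n - y n)"
  using square_summable_add[OF assms(1) square_summable_scale[OF assms(2), of "- 1"]] by simp

lemma square_summable_finite_support: "finite {n. x n \<noteq> 0} \<Longrightarrow> square_summable x"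
  unfolding square_summable_def by (rule summable_finite[of "{n. x n \<noteq> 0}"]) auto

lemma summable_cinner:
  assumes "square_summable x" "square_summable y"
  shows "summable (\<lambda>n. x n * cnj (y n))"
proof (rule summable_comparison_test')
  show "summable (\<lambda>n. (cmod (x n))\<^sup>2 + (cmod (y n))\<^sup>2)"
    using assms unfolding square_summable_def by (rule summable_add)
  fix n :: nat
  have "2 * (cmod (x n) * cmod (y n)) \<le> (cmod (x n))\<^sup>2 + (cmod (y n))\<^sup>2"
    using sum_squares_bound[of "cmod (x n)" "cmod (y n)"] by simp
  moreover have "0 \<le> cmod (x n) * cmod (y n)" by simp
  ultimately show "norm (x n * cnj (y n)) \<le> (cmod (x n))\<^sup>2 + (cmod (y n))\<^sup>2"
    unfolding norm_mult complex_mod_cnj by linarith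
qed

lemma cinner_self:
  assumes "square_summable x"
  shows "cinner ell2 x x = of_real (\<Sum>n. (cmod (x n))\<^sup>2)"
proof -
  have "(\<lambda>n. (cmod (x n))\<^sup>2) sums (\<Sum>n. (cmod (x n))\<^sup>2)"
    using assms unfolding square_summable_def by (rule summable_sums)
  then have "(\<lambda>n. complex_of_real ((cmod (x n))\<^sup>2)) sums of_real (\<Sum>n. (cmod (x n))\<^sup>2)"
    by (rule sums_of_real)
  then have "(\<lambda>n. x n * cnj (x n)) sums of_real (\<Sum>n. (cmod (x n))\<^sup>2)"
    by (simp only: complex_norm_square)
  then show ?thesis by (simp add: sums_iff)
qed

lemma hnorm_ell2: "square_summable x \<Longrightarrow> hnorm ell2 x = sqrt (\<Sum>n. (cmod (x n))\<^sup>2)"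
  unfolding hnorm_def by (subst cinner_self) simp_all

lemma partial_sum_le_hnorm:
  assumes "square_summable x" "finite F"
  shows "(\<Sum>n\<in>F. (cmod (x n))\<^sup>2) \<le> (hnorm ell2 x)\<^sup>2"
proof -
  have s: "summable (\<lambda>n. (cmod (x n))\<^sup>2)" using assms by (simp add: square_summable_def)
  then show ?thesis
    using sum_le_suminf[OF s assms(2)] suminf_nonneg[OF s] by (simp add: hnorm_ell2 assms)
qed

lemma cmod_le_hnorm:
  assumes "square_summable x"
  shows "cmod (x n) \<le> hnorm ell2 x"
proof -
  have "0 \<le> hnorm ell2 x"
    using assms by (simp add: hnorm_ell2 suminf_nonneg square_summable_def)
  then show ?thesis
    using partial_sum_le_hnorm[OF assms, of "{n}"] power2_le_imp_le by auto
qed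

text \<open>This is how membership in the space is obtained for a sequence known only coordinatewise, as
  the limit in the completeness proof is.\<close>

lemma hnorm_le_if_partial_sums:
  assumes "\<And>M. (\<Sum>n<M. (cmod (x n))\<^sup>2) \<le> r\<^sup>2" "0 \<le> r"
  shows "square_summable x" "hnorm ell2 x \<le> r"
proof -
  have s: "summable (\<lambda>n. (cmod (x n))\<^sup>2)"
    by (rule summableI_nonneg_bounded) (use assms in auto)
  then show x: "square_summable x" by (simp add: square_summable_def)
  have "(\<Sum>n. (cmod (x n))\<^sup>2) \<le> r\<^sup>2" using s assms(1) by (rule suminf_le_const)
  then show "hnorm ell2 x \<le> r" using assms(2) by (simp add: hnorm_ell2 x real_le_lsqrt)
qed

lemma ell2_module: "module complex_ring ell2"
proof (rule moduleI)
  have "\<exists>y. y + x = 0" for x :: complex by (rule exI[of _ "- x"]) simp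
  then have "abelian_group complex_ring"
    by (intro abelian_groupI) (auto simp: complex_ring_def algebra_simps)
  moreover have "Group.comm_monoid complex_ring"
    by (intro comm_monoidI) (auto simp: complex_ring_def)
  ultimately show "cring complex_ring"
    by (rule cringI) (auto simp: complex_ring_def algebra_simps)
  have "\<exists>y. square_summable y \<and> (\<lambda>n. y n + x n) = (\<lambda>n. 0)" if "square_summable x" for x
    using square_summable_scale[OF that, of "- 1"] by (intro exI[of _ "\<lambda>n. - x n"]) auto
  then show "abelian_group ell2"
    by (intro abelian_groupI)
      (auto simp: square_summable_zero square_summable_add algebra_simps)
qed (auto simp: complex_ring_def square_summable_scale algebra_simps)

interpretation ell2: complex_inner_product_space ell2
proof (intro complex_inner_product_space.intro ell2_module complex_inner_product_space_axioms.intro)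
  fix x y z :: "nat \<Rightarrow> complex" and c
  assume x: "x \<in> carrier ell2" and y: "y \<in> carrier ell2"
  then have s: "summable (\<lambda>n. x n * cnj (y n))" "summable (\<lambda>n. y n * cnj (x n))"
    by (simp_all add: summable_cinner)
  show "cinner ell2 (c \<odot>\<^bsub>ell2\<^esub> x) y = c * cinner ell2 x y"
    using s by (simp add: suminf_mult mult.assoc)
  have "(\<lambda>n. cnj (y n * cnj (x n))) sums cnj (\<Sum>n. y n * cnj (x n))"
    using s(2) by (simp only: sums_cnj summable_sums)
  then show "cinner ell2 x y = cnj (cinner ell2 y x)"
    by (simp add: sums_iff mult.commute)
  assume z: "z \<in> carrier ell2"
  have "summable (\<lambda>n. x n * cnj (z n))" "summable (\<lambda>n. y n * cnj (z n))"
    using x y z by (simp_all add: summable_cinner)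
  then show "cinner ell2 (x \<oplus>\<^bsub>ell2\<^esub> y) z = cinner ell2 x z + cinner ell2 y z"
    by (simp add: suminf_add algebra_simps)
next
  fix x assume x: "x \<in> carrier ell2" "x \<noteq> \<zero>\<^bsub>ell2\<^esub>"
  then obtain n where n: "x n \<noteq> 0" by auto
  have "summable (\<lambda>n. (cmod (x n))\<^sup>2)" using x by (simp add: square_summable_def)
  then have "0 < (\<Sum>n. (cmod (x n))\<^sup>2)"
    by (rule suminf_pos2[where i = n]) (use n in auto)
  then show "0 < Re (cinner ell2 x x)"
    using x by (subst cinner_self) auto
qed

interpretation ell2_metric: Metric_space "carrier ell2" "hdist ell2"
  by (rule ell2.Metric_space_hdist)

lemma ell2_uminus: "square_summable y \<Longrightarrow> \<ominus>\<^bsub>ell2\<^esub> y = (\<lambda>n. - y n)"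
  using square_summable_scale[of y "- 1"] by (intro ell2.M.minus_equality) auto

lemma ell2_minus:
  assumes "square_summable x" "square_summable y"
  shows "x \<ominus>\<^bsub>ell2\<^esub> y = (\<lambda>n. x n - y n)"
  using assms by (simp add: a_minus_def ell2_uminus)

lemma hdist_ell2:
  assumes "square_summable x" "square_summable y"
  shows "hdist ell2 x y = hnorm ell2 (\<lambda>n. x n - y n)"
  using assms by (simp add: hdist_def ell2_minus)

text \<open>Coordinates are dominated by the norm, so a Cauchy sequence converges in each coordinate; the
  uniform Cauchy estimate then turns the coordinatewise limit into a limit in norm.\<close>

lemma ell2_complete: "ell2_metric.mcomplete"
  unfolding ell2_metric.mcomplete_def
proof (intro allI impI)
  fix s assume "ell2_metric.MCauchy s"
  then have sq: "\<And>k. square_summable (s k)"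
    and cau: "\<And>\<epsilon>. 0 < \<epsilon> \<Longrightarrow> \<exists>N. \<forall>k l. N \<le> k \<longrightarrow> N \<le> l \<longrightarrow> hdist ell2 (s k) (s l) < \<epsilon>"
    unfolding ell2_metric.MCauchy_def by auto
  have "\<exists>c. (\<lambda>k. s k n) \<longlonglongrightarrow> c" for n
  proof -
    have "Cauchy (\<lambda>k. s k n)"
    proof (rule metric_CauchyI)
      fix \<epsilon> :: real assume "0 < \<epsilon>"
      then obtain N where N: "\<And>k l. N \<le> k \<Longrightarrow> N \<le> l \<Longrightarrow> hdist ell2 (s k) (s l) < \<epsilon>"
        using cau by blast
      have "dist (s k n) (s l n) < \<epsilon>" if "N \<le> k" "N \<le> l" for k l
        using N[OF that] cmod_le_hnorm[OF square_summable_diff[OF sq[of k] sq[of l]], of n]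
        by (simp add: hdist_ell2 sq dist_norm)
      then show "\<exists>N. \<forall>k\<ge>N. \<forall>l\<ge>N. dist (s k n) (s l n) < \<epsilon>" by blast
    qed
    then show ?thesis by (simp add: Cauchy_convergent_iff convergent_def)
  qed
  then obtain x where lim: "\<And>n. (\<lambda>k. s k n) \<longlonglongrightarrow> x n" by metis
  \<comment> \<open>The Cauchy estimate for finitely many coordinates survives the passage to the limit in one
    of the two indices, which bounds every partial sum of the squared distance to the limit.\<close>
  have tail: "\<exists>N. \<forall>k\<ge>N. square_summable (\<lambda>n. s k n - x n) \<and> hnorm ell2 (\<lambda>n. s k n - x n) \<le> \<epsilon>"
    if \<epsilon>: "0 < \<epsilon>" for \<epsilon>
  proof -
    obtain N where N: "\<And>k l. N \<le> k \<Longrightarrow> N \<le> l \<Longrightarrow> hdist ell2 (s k) (s l) < \<epsilon>"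
      using cau[OF \<epsilon>] by blast
    have "(\<Sum>n<M. (cmod (s k n - x n))\<^sup>2) \<le> \<epsilon>\<^sup>2" if k: "N \<le> k" for k M
    proof (rule LIMSEQ_le_const2)
      show "(\<lambda>l. \<Sum>n<M. (cmod (s k n - s l n))\<^sup>2) \<longlonglongrightarrow> (\<Sum>n<M. (cmod (s k n - x n))\<^sup>2)"
        by (intro tendsto_intros lim)
      have "(\<Sum>n<M. (cmod (s k n - s l n))\<^sup>2) \<le> \<epsilon>\<^sup>2" if "N \<le> l" for l
      proof -
        have "(\<Sum>n<M. (cmod (s k n - s l n))\<^sup>2) \<le> (hdist ell2 (s k) (s l))\<^sup>2"
          using partial_sum_le_hnorm[OF square_summable_diff[OF sq sq]]
          by (simp add: hdist_ell2 sq)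
        also have "\<dots> \<le> \<epsilon>\<^sup>2"
          using N[OF k that] by (intro power_mono) auto
        finally show ?thesis .
      qed
      then show "\<exists>L. \<forall>l\<ge>L. (\<Sum>n<M. (cmod (s k n - s l n))\<^sup>2) \<le> \<epsilon>\<^sup>2" by blast
    qed
    then show ?thesis
      using hnorm_le_if_partial_sums[of "\<lambda>n. s _ n - x n" \<epsilon>] \<epsilon> by (metis less_imp_le)
  qed
  obtain k where "square_summable (\<lambda>n. s k n - x n)" using tail[of 1] by auto
  from square_summable_diff[OF sq[of k] this] have x: "square_summable x" by simp
  have "\<exists>N. \<forall>k\<ge>N. hdist ell2 (s k) x < \<epsilon>" if \<epsilon>: "0 < \<epsilon>" for \<epsilon>
  proof -
    obtain N where "\<forall>k\<ge>N. hnorm ell2 (\<lambda>n. s k n - x n) \<le> \<epsilon> / 2"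
      using tail[of "\<epsilon> / 2"] \<epsilon> by auto
    then show ?thesis using \<epsilon> by (intro exI[of _ N]) (fastforce simp: hdist_ell2 sq x)
  qed
  then have "limitin ell2_metric.mtopology s x sequentially"
    unfolding ell2_metric.limit_metric_sequentially using sq x by auto
  then show "\<exists>x. limitin ell2_metric.mtopology s x sequentially"
    by blast
qed

lemma ell2_hilbert: "complex_hilbert_space ell2"
  by (intro complex_hilbert_space.intro complex_hilbert_space_axioms.intro
      ell2.complex_inner_product_space_axioms ell2_complete)

text \<open>The squared distance from \<open>x\<close> to its truncation is a tail of the convergent series for the
  squared norm of \<open>x\<close>.\<close>

lemma truncation_approximates:
  assumes x: "square_summable x" and "0 < \<epsilon>"
  shows "\<exists>M. hnorm ell2 (\<lambda>n. x n - (if n < M then x n else 0)) < \<epsilon>"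
proof -
  have s: "summable (\<lambda>n. (cmod (x n))\<^sup>2)" using x by (simp add: square_summable_def)
  obtain M where "norm (\<Sum>i. (cmod (x (i + M)))\<^sup>2) < \<epsilon>\<^sup>2"
    using suminf_exist_split[OF _ s, of "\<epsilon>\<^sup>2"] assms by auto
  then have M: "(\<Sum>i. (cmod (x (i + M)))\<^sup>2) < \<epsilon>\<^sup>2" by (simp add: abs_less_iff)
  let ?y = "\<lambda>n. x n - (if n < M then x n else 0)"
  have y: "square_summable ?y"
    by (intro square_summable_diff x square_summable_finite_support)
      (auto intro: finite_subset[of _ "{..<M}"])
  then have "(\<Sum>n. (cmod (?y n))\<^sup>2) = (\<Sum>i. (cmod (?y (i + M)))\<^sup>2) + (\<Sum>n<M. (cmod (?y n))\<^sup>2)"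
    unfolding square_summable_def by (rule suminf_split_initial_segment)
  then have "(\<Sum>n. (cmod (?y n))\<^sup>2) < \<epsilon>\<^sup>2" using M by simp
  then show ?thesis
    using y \<open>0 < \<epsilon>\<close> by (intro exI[of _ M]) (simp add: hnorm_ell2 real_less_lsqrt)
qed

section \<open>Diagonal operators\<close>

definition unit_vector :: "nat \<Rightarrow> nat \<Rightarrow> complex" where
  "unit_vector m = (\<lambda>n. if n = m then 1 else 0)"

text \<open>The domain is the maximal one, since a proper restriction of a self-adjoint operator is never
  self-adjoint.\<close>

definition diagonal :: "(nat \<Rightarrow> real) \<Rightarrow> (nat \<Rightarrow> complex) \<rightharpoonup> (nat \<Rightarrow> complex)" where
  "diagonal a = (\<lambda>x. if square_summable x \<and> square_summable (\<lambda>n. of_real (a n) * x n)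
    then Some (\<lambda>n. of_real (a n) * x n) else None)"

lemma dom_diagonal:
  "x \<in> dom (diagonal a) \<longleftrightarrow> square_summable x \<and> square_summable (\<lambda>n. of_real (a n) * x n)"
  by (auto simp: diagonal_def dom_def split: if_splits)

lemma diagonal_eq_Some:
  "diagonal a x = Some y \<longleftrightarrow> square_summable x \<and> square_summable y \<and> (\<forall>n. y n = of_real (a n) * x n)"
proof -
  have "(\<forall>n. y n = of_real (a n) * x n) \<longleftrightarrow> (\<lambda>n. of_real (a n) * x n) = y" by auto
  then show ?thesis unfolding diagonal_def by (auto split: if_splits)
qed

lemma the_diagonal: "x \<in> dom (diagonal a) \<Longrightarrow> the (diagonal a x) = (\<lambda>n. of_real (a n) * x n)"
  by (auto simp: diagonal_def)

lemma finite_support_in_dom_diagonal: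
  assumes "finite {n. x n \<noteq> 0}"
  shows "x \<in> dom (diagonal a)"
  unfolding dom_diagonal using assms
  by (auto intro!: square_summable_finite_support elim: rev_finite_subset)

lemma finite_support_unit_vector: "finite {n. unit_vector m n \<noteq> 0}"
  by (rule finite_subset[of _ "{m}"]) (auto simp: unit_vector_def)

lemmas square_summable_unit_vector =
  square_summable_finite_support[OF finite_support_unit_vector]
lemmas unit_vector_in_dom_diagonal =
  finite_support_in_dom_diagonal[OF finite_support_unit_vector]

lemma hnorm_scaled_unit_vector: "hnorm ell2 (\<lambda>n. c * unit_vector m n) = cmod c"
proof -
  have "(\<lambda>n. (cmod (c * unit_vector m n))\<^sup>2) = (\<lambda>n. if n = m then (cmod c)\<^sup>2 else 0)"
    by (auto simp: unit_vector_def)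
  then have "(\<lambda>n. (cmod (c * unit_vector m n))\<^sup>2) sums (cmod c)\<^sup>2"
    using sums_single[of m "\<lambda>_. (cmod c)\<^sup>2"] by simp
  then show ?thesis
    by (simp add: hnorm_ell2 square_summable_scale square_summable_unit_vector sums_iff)
qed

lemma linear_operator_diagonal: "linear_operator ell2 (diagonal a)"
proof -
  have add: "square_summable (\<lambda>n. of_real (a n) * (x n + y n))"
    if "square_summable (\<lambda>n. of_real (a n) * x n)" "square_summable (\<lambda>n. of_real (a n) * y n)" for x y
    using square_summable_add[OF that] by (simp add: algebra_simps)
  have scale: "square_summable (\<lambda>n. of_real (a n) * (c * x n))"
    if "square_summable (\<lambda>n. of_real (a n) * x n)" for c x
    using square_summable_scale[OF that, of c] by (simp add: mult.left_commute)
  have "submodule (dom (diagonal a)) complex_ring ell2"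
  proof (rule ell2.submoduleI)
    fix x assume "x \<in> dom (diagonal a)"
    then show "\<ominus>\<^bsub>ell2\<^esub> x \<in> dom (diagonal a)"
      using scale[of x "- 1"] square_summable_scale[of x "- 1"] by (simp add: dom_diagonal ell2_uminus)
  qed (auto simp: dom_diagonal diagonal_eq_Some square_summable_zero square_summable_add square_summable_scale
      intro: add scale)
  moreover have "ran (diagonal a) \<subseteq> carrier ell2"
    by (auto simp: ran_def diagonal_eq_Some)
  moreover have "(\<lambda>n. x n + y n) \<in> dom (diagonal a)"
    if "x \<in> dom (diagonal a)" "y \<in> dom (diagonal a)" for x y
    using that by (auto simp: dom_diagonal square_summable_add intro: add)
  moreover have "(\<lambda>n. c * x n) \<in> dom (diagonal a)" if "x \<in> dom (diagonal a)" for c x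
    using that by (auto simp: dom_diagonal square_summable_scale intro: scale)
  ultimately show ?thesis
    unfolding linear_operator_def by (simp add: the_diagonal algebra_simps del: domIff)
qed

text \<open>The domain contains all finitely supported sequences.\<close>

lemma densely_defined_diagonal: "densely_defined ell2 (diagonal a)"
proof -
  have "\<exists>y\<in>dom (diagonal a). y \<in> ell2_metric.mball x r" if x: "square_summable x" and "0 < r" for x r
  proof -
    obtain M where M: "hnorm ell2 (\<lambda>n. x n - (if n < M then x n else 0)) < r"
      using truncation_approximates[OF x \<open>0 < r\<close>] by blast
    let ?y = "\<lambda>n. if n < M then x n else 0"
    have "?y \<in> dom (diagonal a)"
      by (rule finite_support_in_dom_diagonal) (auto intro: finite_subset[of _ "{..<M}"])
    moreover from this have "square_summable ?y" by (simp only: dom_diagonal)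
    ultimately show ?thesis
      unfolding ell2_metric.in_mball using M x by (intro bexI[of _ ?y]) (simp_all add: hdist_ell2)
  qed
  then show ?thesis
    unfolding densely_defined_def htopology_def ell2_metric.metric_closure_of by auto
qed

lemma continuous_map_coordinate: "continuous_map (htopology ell2) euclidean (\<lambda>x. x n)"
  unfolding htopology_def ell2_metric.continuous_map_from_metric
proof (intro conjI ballI allI impI)
  fix x U assume x: "x \<in> carrier ell2" and "openin euclidean U \<and> x n \<in> (U :: complex set)"
  then have "open U" "x n \<in> U" using open_openin[of U] by blast+
  then obtain r where r: "0 < r" "ball (x n) r \<subseteq> U" by (rule openE)
  have "y n \<in> U" if "y \<in> carrier ell2" "hdist ell2 x y < r" for y
  proof -
    have "cmod (x n - y n) \<le> hdist ell2 x y"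
      using that x cmod_le_hnorm[OF square_summable_diff[of x y], of n] by (simp add: hdist_ell2)
    then have "y n \<in> ball (x n) r" using that(2) by (simp add: dist_norm)
    then show ?thesis using r(2) by blast
  qed
  with r(1) show "\<exists>r>0. \<forall>y. y \<in> carrier ell2 \<and> hdist ell2 x y < r \<longrightarrow> y n \<in> U" by blast
qed simp

text \<open>Because the domain is maximal, the graph is cut out of the whole product space by the
  equations \<open>a\<^sub>n x\<^sub>n = y\<^sub>n\<close>, each of which compares two continuous functions.\<close>

lemma closed_operator_diagonal: "closed_operator ell2 (diagonal a)"
proof -
  let ?X = "prod_topology (htopology ell2) (htopology ell2)"
  let ?C = "\<lambda>n. {p \<in> topspace ?X. of_real (a n) * fst p n = snd p n}"
  have top: "topspace (htopology ell2) = carrier ell2"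
    unfolding htopology_def by (rule ell2_metric.topspace_mtopology)
  have fst: "continuous_map ?X euclidean (\<lambda>p. fst p n)" for n
    using continuous_map_compose[OF continuous_map_fst continuous_map_coordinate]
    by (simp only: o_def)
  have snd: "continuous_map ?X euclidean (\<lambda>p. snd p n)" for n
    using continuous_map_compose[OF continuous_map_snd continuous_map_coordinate]
    by (simp only: o_def)
  have scale: "continuous_map euclidean euclidean (\<lambda>z. of_real (a n) * z :: complex)" for n
    unfolding continuous_map_iff_continuous2 by (intro continuous_intros)
  have "closedin ?X (?C n)" for n
  proof (rule closedin_continuous_maps_eq[OF Hausdorff_space_euclidean _ snd])
    show "continuous_map ?X euclidean (\<lambda>p. of_real (a n) * fst p n)"
      using continuous_map_compose[OF fst scale] by (simp only: o_def)
  qed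
  then have "closedin ?X (\<Inter>n. ?C n)" by (intro closedin_Inter) auto
  also have "(\<Inter>n. ?C n) = Map.graph (diagonal a)"
    unfolding topspace_prod_topology top by (auto simp: Map.graph_def diagonal_eq_Some)
  finally show ?thesis by (simp add: closed_operator_def)
qed

lemma cinner_unit_vector: "cinner ell2 (\<lambda>n. c * unit_vector m n) y = c * cnj (y m)"
proof -
  have "(\<lambda>n. c * unit_vector m n * cnj (y n)) = (\<lambda>n. if n = m then c * cnj (y m) else 0)"
    by (auto simp: unit_vector_def)
  then have "(\<lambda>n. c * unit_vector m n * cnj (y n)) sums (c * cnj (y m))"
    using sums_single[of m "\<lambda>_. c * cnj (y m)"] by simp
  then show ?thesis by (simp add: sums_iff)
qed

lemma diagonal_unit_vector: "the (diagonal a (unit_vector m)) = (\<lambda>n. of_real (a m) * unit_vector m n)"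
  by (subst the_diagonal[OF unit_vector_in_dom_diagonal]) (auto simp: unit_vector_def)

text \<open>Testing the defining identity of the adjoint on unit vectors determines each coordinate of
  the image: since \<open>a\<^sub>n\<close> is real, the value found is \<open>a\<^sub>n y\<^sub>n\<close>, that of the operator itself. The
  requirement that the image be square-summable reproduces the domain.\<close>

lemma selfadjoint_diagonal: "selfadjoint_operator ell2 (diagonal a)"
proof -
  define P where "P y z \<longleftrightarrow> z \<in> carrier ell2 \<and>
    (\<forall>x\<in>dom (diagonal a). cinner ell2 (the (diagonal a x)) y = cinner ell2 x z)" for y z
  have "z = (\<lambda>n. of_real (a n) * y n)" if "P y z" for y z
  proof
    fix m
    have "cinner ell2 (\<lambda>n. of_real (a m) * unit_vector m n) y = cinner ell2 (unit_vector m) z"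
      using that unit_vector_in_dom_diagonal[of m a] diagonal_unit_vector[of a m]
      unfolding P_def by metis
    then have "cnj (of_real (a m) * y m) = cnj (z m)"
      using cinner_unit_vector[of "of_real (a m)" m y] cinner_unit_vector[of 1 m z] by simp
    then show "z m = of_real (a m) * y m"
      unfolding complex_cnj_cancel_iff by (rule sym)
  qed
  moreover have "P y (\<lambda>n. of_real (a n) * y n)" if "square_summable (\<lambda>n. of_real (a n) * y n)" for y
  proof -
    have "cinner ell2 (the (diagonal a x)) y = cinner ell2 x (\<lambda>n. of_real (a n) * y n)"
      if "x \<in> dom (diagonal a)" for x
      unfolding the_diagonal[OF that] by (simp add: mult_ac)
    then show ?thesis unfolding P_def using that by simp
  qed
  moreover have "square_summable z" if "P y z" for y z
    using that by (simp add: P_def)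
  ultimately have P: "P y z \<longleftrightarrow> z = (\<lambda>n. of_real (a n) * y n) \<and> square_summable z" for y z
    by blast
  have "adjoint_operator ell2 (diagonal a) y = diagonal a y" for y
    unfolding adjoint_operator_def P_def[symmetric] P by (auto simp: diagonal_def)
  then show ?thesis
    unfolding selfadjoint_operator_def
    using linear_operator_diagonal densely_defined_diagonal by blast
qed

lemma unbounded_diagonal:
  assumes "\<And>K. \<exists>n. K < \<bar>a n\<bar>"
  shows "\<not> bounded_operator ell2 (diagonal a)"
proof
  assume "bounded_operator ell2 (diagonal a)"
  then obtain K where K: "\<And>x. x \<in> dom (diagonal a) \<Longrightarrow> hnorm ell2 (the (diagonal a x)) \<le> K * hnorm ell2 x"
    unfolding bounded_operator_def by blast
  obtain m where "K < \<bar>a m\<bar>" using assms by blast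
  with K[OF unit_vector_in_dom_diagonal, of m] show False
    using hnorm_scaled_unit_vector[of 1 m] hnorm_scaled_unit_vector[of "of_real (a m)" m]
    by (simp add: diagonal_unit_vector)
qed

section \<open>Intertwining operators\<close>

text \<open>By linearity the operator vanishes on every truncation of \<open>x\<close>, and these converge to \<open>x\<close>.\<close>

lemma bounded_operator_eq_zero:
  assumes T: "T \<in> bounded_operators ell2" and e: "\<And>m. T (unit_vector m) = Some (\<lambda>n. 0)"
  shows "T = zero_operator ell2"
proof
  fix x
  have lin: "linear_operator ell2 T" and dom: "dom T = carrier ell2"
    and bd: "bounded_operator ell2 T"
    using T by (auto simp: bounded_operators_def)
  have T_closed: "square_summable (the (T y))" if "square_summable y" for y
  proof -
    have "y \<in> dom T" using that dom by simp
    then show ?thesis using lin by (auto simp: linear_operator_def ran_def)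
  qed
  have T_add: "the (T (\<lambda>n. y n + z n)) = (\<lambda>n. the (T y) n + the (T z) n)"
    if "square_summable y" "square_summable z" for y z
    using lin that unfolding linear_operator_def dom by simp
  have T_scale: "the (T (\<lambda>n. c * y n)) = (\<lambda>n. c * the (T y) n)" if "square_summable y" for c y
    using lin that unfolding linear_operator_def dom by simp
  show "T x = zero_operator ell2 x"
  proof (cases "square_summable x")
    case False
    then have "x \<notin> dom T" using dom by simp
    with False show ?thesis by (auto simp: zero_operator_def restrict_map_def)
  next
    case x: True
    define y where "y M = (\<lambda>n. if n < M then x n else 0)" for M
    have sq: "square_summable (y M)" for M
      unfolding y_def
      by (intro square_summable_finite_support) (auto intro: finite_subset[of _ "{..<M}"])
    have y0: "the (T (y M)) = (\<lambda>n. 0)" for M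
    proof (induction M)
      case 0
      have "y 0 = (\<lambda>n. 0 * unit_vector 0 n)" by (simp add: y_def)
      then show ?case using T_scale[OF square_summable_unit_vector, of 0 0] by simp
    next
      case (Suc M)
      have "y (Suc M) = (\<lambda>n. y M n + x M * unit_vector M n)"
        by (simp add: y_def unit_vector_def fun_eq_iff less_Suc_eq)
      then show ?case
        using Suc T_add[OF sq square_summable_scale[OF square_summable_unit_vector]]
          T_scale[OF square_summable_unit_vector] by (simp add: e)
    qed
    \<comment> \<open>The bound \<open>K\<close> is not known to be positive, so \<open>\<bar>K\<bar> + 1\<close> takes its place as a divisor.\<close>
    obtain K where K: "\<And>z. square_summable z \<Longrightarrow> hnorm ell2 (the (T z)) \<le> K * hnorm ell2 z"
      using bd dom unfolding bounded_operator_def by auto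
    have "hnorm ell2 (the (T x)) \<le> 0 + \<epsilon>" if \<epsilon>: "0 < \<epsilon>" for \<epsilon>
    proof -
      obtain M where M: "hnorm ell2 (\<lambda>n. x n - y M n) < \<epsilon> / (\<bar>K\<bar> + 1)"
        using truncation_approximates[OF x, of "\<epsilon> / (\<bar>K\<bar> + 1)"] \<epsilon> unfolding y_def by auto
      have d: "square_summable (\<lambda>n. x n - y M n)" using x sq by (rule square_summable_diff)
      have "the (T x) = the (T (\<lambda>n. x n - y M n))"
        using T_add[OF d sq[of M]] y0 by simp
      then have "hnorm ell2 (the (T x)) \<le> K * hnorm ell2 (\<lambda>n. x n - y M n)"
        using K[OF d] by simp
      also have "\<dots> \<le> (\<bar>K\<bar> + 1) * hnorm ell2 (\<lambda>n. x n - y M n)"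
        using cmod_le_hnorm[OF d, of 0] norm_ge_zero[of "x 0 - y M 0"]
        by (intro mult_right_mono) linarith+
      also have "\<dots> \<le> \<epsilon>"
        using M by (simp add: field_simps)
      finally show ?thesis by simp
    qed
    then have "hnorm ell2 (the (T x)) \<le> 0" by (rule field_le_epsilon)
    then have "cmod (the (T x) n) \<le> 0" for n
      using cmod_le_hnorm[OF T_closed[OF x], of n] by (rule order_trans[rotated])
    then have "the (T x) = (\<lambda>n. 0)" by auto
    moreover have "x \<in> dom T" using x dom by simp
    ultimately show ?thesis using x by (auto simp: zero_operator_def)
  qed
qed

text \<open>Applied to a unit vector, the inclusion turns an eigenvector of \<open>diagonal a\<close> with eigenvalue
  \<open>a m\<close> into a vector \<open>v\<close> with \<open>b n * v n = a m * v n\<close> for all \<open>n\<close>; disjointness of the two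
  diagonals leaves only \<open>v = 0\<close>.\<close>

lemma diagonal_intertwiner_eq_zero:
  assumes T: "T \<in> bounded_operators ell2"
    and sub: "T \<circ>\<^sub>m diagonal a \<subseteq>\<^sub>m diagonal b \<circ>\<^sub>m T"
    and disjoint: "\<And>m n. a m \<noteq> b n"
  shows "T = zero_operator ell2"
proof (rule bounded_operator_eq_zero[OF T])
  fix m
  have lin: "linear_operator ell2 T" and dom: "dom T = carrier ell2"
    using T by (auto simp: bounded_operators_def)
  obtain v where v: "T (unit_vector m) = Some v"
    using dom square_summable_unit_vector[of m] by auto
  let ?w = "\<lambda>n. of_real (a m) * unit_vector m n"
  have A: "diagonal a (unit_vector m) = Some ?w"
    using unit_vector_in_dom_diagonal[of m a] diagonal_unit_vector[of a m]
    by (metis domIff option.collapse)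
  have "?w \<in> dom T"
    using dom by (simp add: square_summable_scale square_summable_unit_vector)
  moreover have "the (T ?w) = (\<lambda>n. of_real (a m) * v n)"
    using lin v square_summable_unit_vector[of m] unfolding linear_operator_def dom by simp
  ultimately have "T ?w = Some (\<lambda>n. of_real (a m) * v n)" by auto
  then have "(T \<circ>\<^sub>m diagonal a) (unit_vector m) = Some (\<lambda>n. of_real (a m) * v n)"
    using A by (simp add: map_comp_def)
  then have "(diagonal b \<circ>\<^sub>m T) (unit_vector m) = Some (\<lambda>n. of_real (a m) * v n)"
    using sub by (metis domI map_le_def)
  then have "diagonal b v = Some (\<lambda>n. of_real (a m) * v n)"
    using v by (simp add: map_comp_def)
  then have "of_real (a m) * v n = of_real (b n) * v n" for n
    by (simp add: diagonal_eq_Some)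
  then have "v n = 0" for n using disjoint[of m n] by (metis mult_right_cancel of_real_eq_iff)
  then have "v = (\<lambda>n. 0)" by auto
  with v show "T (unit_vector m) = Some (\<lambda>n. 0)" by simp
qed

theorem proposition2p8:
  shows "\<exists>(H :: (nat \<Rightarrow> complex) inner_product_space) A B.
    complex_hilbert_space H \<and>
    selfadjoint_operator H A \<and> \<not> bounded_operator H A \<and>
    linear_operator H B \<and> densely_defined H B \<and> closed_operator H B \<and> \<not> bounded_operator H B \<and>
    (\<forall>T\<in>bounded_operators H. T \<circ>\<^sub>m A \<subseteq>\<^sub>m B \<circ>\<^sub>m T \<longrightarrow> T = zero_operator H) \<and>
    (\<forall>S\<in>bounded_operators H. S \<circ>\<^sub>m B \<subseteq>\<^sub>m A \<circ>\<^sub>m S \<longrightarrow> S = zero_operator H)"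
proof -
  let ?a = "\<lambda>n. real n" and ?b = "\<lambda>n. - real n - 1"
  have disjoint: "?a m \<noteq> ?b n" "?b m \<noteq> ?a n" for m n by linarith+
  have large: "\<exists>n. K < \<bar>?a n\<bar>" "\<exists>n. K < \<bar>?b n\<bar>" for K
  proof -
    obtain n where "K < real n" using reals_Archimedean2 by blast
    then have "K < \<bar>?a n\<bar>" "K < \<bar>?b n\<bar>" by simp_all
    then show "\<exists>n. K < \<bar>?a n\<bar>" "\<exists>n. K < \<bar>?b n\<bar>" by blast+
  qed
  have unbounded: "\<not> bounded_operator ell2 (diagonal ?a)" "\<not> bounded_operator ell2 (diagonal ?b)"
    by (rule unbounded_diagonal, rule large)+
  show ?thesis
  proof (intro exI conjI ballI impI)
    fix T assume "T \<in> bounded_operators ell2" "T \<circ>\<^sub>m diagonal ?a \<subseteq>\<^sub>m diagonal ?b \<circ>\<^sub>m T"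
    then show "T = zero_operator ell2" by (rule diagonal_intertwiner_eq_zero) (rule disjoint)
  next
    fix S assume "S \<in> bounded_operators ell2" "S \<circ>\<^sub>m diagonal ?b \<subseteq>\<^sub>m diagonal ?a \<circ>\<^sub>m S"
    then show "S = zero_operator ell2" by (rule diagonal_intertwiner_eq_zero) (rule disjoint)
  qed (rule ell2_hilbert selfadjoint_diagonal unbounded linear_operator_diagonal
      densely_defined_diagonal closed_operator_diagonal)+
qed

end
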